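(* Let $n\ge 1$ and let $\tau,\mu$ be two unknown distributions over $\{0,1\}^n$, where $\tau$ is accessible through the prefix oracle and $\mu$ is accessible through the marginal prefix oracle. For every $\varepsilon>0$ there is an algorithm that makes $\tilde{O}(n/\varepsilon^2)$ queries and distinguishes between the case $\tau=\mu$ and the case $d_{TV}(\tau,\mu)>\varepsilon$; that is, if $\tau=\mu$ it accepts with probability at least $2/3$, and if $d_{TV}(\tau,\mu)>\varepsilon$ it rejects with probability at least $2/3$.
   Context: For $I\subseteq[n]$ and $x\in\{0,1\}^n$, $x_I$ denotes the restriction of $x$ to the coordinates in $I$, and $[k]=\{1,\dots,k\}$. The prefix oracle to a distribution $\tau$ over $\{0,1\}^n$ takes as input some $0\le k\le n-1$ and $w\in\{0,1\}^k$, and returns an independent sample $x$ drawn from $\tau$ conditioned on $x_{[k]}=w$ (it indicates an error if this event has probability $0$). The marginal prefix oracle to $\mu$ takes as input an index $i\in[n]$ and $w\in\{0,1\}^{i-1}$, and returns a single independent bit distributed as $x_i$ where $x$ is drawn from $\mu$ conditioned on $x_{[i-1]}=w$ (error if this event has probability $0$). $d_{TV}(\tau,\mu)=\frac12\sum_x|\tau(x)-\mu(x)|$. The notation $\tilde O(\cdot)$ hides factors polylogarithmic in $n$ and $1/\varepsilon$. *)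

theory Defs
  imports "HOL-Probability.Probability"
begin

definition cube :: "nat \<Rightarrow> bool list set" where
  "cube n = {x. length x = n}"

definition d_TV :: "nat \<Rightarrow> bool list pmf \<Rightarrow> bool list pmf \<Rightarrow> real" where
  "d_TV n \<tau> \<mu> = (1 / 2) * (\<Sum>x\<in>cube n. \<bar>pmf \<tau> x - pmf \<mu> x\<bar>)"

definition prefix_event :: "bool list \<Rightarrow> bool list set" where
  "prefix_event w = {x. take (length w) x = w}"

text \<open>
  The input \<open>k\<close> of the prefix oracle is \<open>length w\<close>. The answer \<open>None\<close> is the error indication; it
  is also the answer to inputs outside the oracle's domain (\<open>length w \<ge> n\<close>).
\<close>

definition prefix_oracle :: "nat \<Rightarrow> bool list pmf \<Rightarrow> bool list \<Rightarrow> bool list option pmf" where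
  "prefix_oracle n \<tau> w =
     (if length w < n \<and> measure_pmf.prob \<tau> (prefix_event w) > 0
      then map_pmf Some (cond_pmf \<tau> (prefix_event w))
      else return_pmf None)"

text \<open>
  The input \<open>i\<close> of the marginal prefix oracle is \<open>length w + 1\<close>, so the bit \<open>x\<^sub>i\<close> is
  \<open>x ! length w\<close> (lists are indexed from 0).
\<close>

definition marginal_prefix_oracle :: "nat \<Rightarrow> bool list pmf \<Rightarrow> bool list \<Rightarrow> bool option pmf" where
  "marginal_prefix_oracle n \<mu> w =
     (if length w < n \<and> measure_pmf.prob \<mu> (prefix_event w) > 0
      then map_pmf (\<lambda>x. Some (x ! length w)) (cond_pmf \<mu> (prefix_event w))
      else return_pmf None)"

text \<open>
  Randomized adaptive query algorithms as decision trees: stop with a verdict (\<open>True\<close> means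
  accept), continue with a randomly chosen subtree (internal randomness, no query), or query one
  of the two oracles and continue depending on the answer.
\<close>

datatype tester =
    Verdict bool
  | Random "tester pmf"
  | Query_Prefix "bool list" "bool list option \<Rightarrow> tester"
  | Query_Marginal "bool list" "bool option \<Rightarrow> tester"

primrec run :: "nat \<Rightarrow> bool list pmf \<Rightarrow> bool list pmf \<Rightarrow> tester \<Rightarrow> bool pmf" where
  "run n \<tau> \<mu> (Verdict b) = return_pmf b"
| "run n \<tau> \<mu> (Random p) = join_pmf (map_pmf (run n \<tau> \<mu>) p)"
| "run n \<tau> \<mu> (Query_Prefix w f) =
     bind_pmf (prefix_oracle n \<tau> w) (\<lambda>r. run n \<tau> \<mu> (f r))"
| "run n \<tau> \<mu> (Query_Marginal w f) =
     bind_pmf (marginal_prefix_oracle n \<mu> w) (\<lambda>r. run n \<tau> \<mu> (f r))"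

text \<open>Worst-case number of queries, over all internal random choices and all oracle answers.\<close>

primrec queries :: "tester \<Rightarrow> enat" where
  "queries (Verdict b) = 0"
| "queries (Random p) = Sup (set_pmf (map_pmf queries p))"
| "queries (Query_Prefix w f) = eSuc (SUP r. queries (f r))"
| "queries (Query_Marginal w f) = eSuc (SUP r. queries (f r))"

end

theory Submission
  imports Defs
begin

text \<open>
  For a prefix \<open>w\<close> let \<open>p\<close> and \<open>q\<close> be the probabilities that the next bit is 1 under \<open>\<tau>\<close> and \<open>\<mu>\<close>,
  let \<open>d = p - q\<close>, let \<open>s = p + q - 2pq\<close> be the probability that independent next bits drawn from \<open>\<tau>\<close>
  and \<open>\<mu>\<close> differ, and call \<open>d\<^sup>2 / s\<close> the gap at \<open>w\<close>. Since \<open>R \<mapsto> R / (1 + R)\<close> is bounded and concave,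
  following its expectation under \<open>\<tau>\<close> along the likelihood ratio \<open>R = \<mu>(w) / \<tau>(w)\<close> of growing prefixes
  shows that the \<open>\<tau>\<close>-expected gaps sum up to at least \<open>d_TV\<^sup>2 / 4\<close>. So at a random prefix of a sample
  from \<open>\<tau>\<close> the expected gap is at least of order \<open>\<epsilon>\<^sup>2 / n\<close>.

  At such a prefix the tester bets against \<open>p = q\<close>: it repeatedly draws a next bit \<open>a\<close> from \<open>\<tau>\<close> and
  \<open>b\<close> from \<open>\<mu>\<close> and multiplies its wealth by \<open>1 + \<beta>(a - b)\<close>. If \<open>p = q\<close> the expected wealth stays 1, so
  the wealth rarely reaches a large threshold. If \<open>\<beta>\<close> is close to \<open>d / (4s)\<close>, then the expected inverse
  wealth decays exponentially at a rate proportional to the gap. It remains to try all dyadic scales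
  of the gap and of \<open>\<beta>\<close>.
\<close>

section \<open>The gap between two bits\<close>

text \<open>On the unit square the denominator vanishes only if \<open>p = q\<close> is 0 or 1, and
  division by zero then yields the fitting value 0.\<close>

definition gap :: "real \<Rightarrow> real \<Rightarrow> real" where
  "gap p q = (p - q)\<^sup>2 / (p + q - 2 * p * q)"

text \<open>Half the harmonic mean. It is \<open>A * (R / (1 + R))\<close> with
  \<open>R = B / A\<close>, in a symmetric form that also gives 0 when \<open>A\<close> or
  \<open>B\<close> is 0.\<close>

definition overlap :: "real \<Rightarrow> real \<Rightarrow> real" where
  "overlap A B = A * B / (A + B)"

text \<open>The right-hand side exceeds \<open>p - q\<close> by \<open>2 * q * (1 - p)\<close> and
  \<open>q - p\<close> by \<open>2 * p * (1 - q)\<close>.\<close>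

lemma disagreement_ge:
  fixes p q :: real
  assumes "0 \<le> p" "p \<le> 1" "0 \<le> q" "q \<le> 1"
  shows "\<bar>p - q\<bar> \<le> p + q - 2 * p * q"
proof -
  have "0 \<le> p * (1 - q)" "0 \<le> q * (1 - p)"
    using assms by auto
  then show ?thesis
    by (auto simp: abs_if algebra_simps)
qed

lemma gap_bounds:
  assumes "0 \<le> p" "p \<le> 1" "0 \<le> q" "q \<le> 1"
  shows "0 \<le> gap p q" "gap p q \<le> \<bar>p - q\<bar> / (p + q - 2 * p * q)" "gap p q \<le> 1"
proof -
  let ?s = "p + q - 2 * p * q"
  have s: "\<bar>p - q\<bar> \<le> ?s" "0 \<le> ?s"
    using disagreement_ge[OF assms] by auto
  show "0 \<le> gap p q"
    unfolding gap_def using s by (intro divide_nonneg_nonneg) auto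
  have "\<bar>p - q\<bar> * \<bar>p - q\<bar> \<le> \<bar>p - q\<bar> * 1"
    using assms by (intro mult_left_mono) auto
  then have "(p - q)\<^sup>2 \<le> \<bar>p - q\<bar>"
    by (simp add: power2_eq_square)
  then show *: "gap p q \<le> \<bar>p - q\<bar> / ?s"
    unfolding gap_def by (intro divide_right_mono s)
  also have "\<dots> \<le> 1"
    using s by (auto simp: divide_le_eq)
  finally show "gap p q \<le> 1" .
qed

text \<open>\<open>overlap\<close> is concave and homogeneous, and the first term on the right is
  its tangent plane at \<open>(A, B)\<close>, evaluated at \<open>(A * p, B * q)\<close>. The loss
  is charged to \<open>A\<close> alone because later only \<tau> weights the gaps.\<close>

lemma overlap_bit:
  fixes A B p q :: real
  assumes "0 < A" "0 < B" "0 \<le> p" "0 \<le> q"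
  shows "overlap (A * p) (B * q) \<ge>
    overlap A B * ((B * p + A * q) / (A + B)) - A * ((p - q)\<^sup>2 / (p + q))"
proof (cases "p + q = 0")
  case True
  then have "p = 0" "q = 0"
    using assms by auto
  then show ?thesis
    by (simp add: overlap_def)
next
  case False
  then have pq: "p + q > 0"
    using assms by auto
  have D: "A * p + B * q > 0"
    using pq assms by (smt (verit) mult_nonneg_nonneg mult_pos_pos)
  have S: "A + B > 0"
    using assms by auto
  have eq: "overlap (A * p) (B * q) = overlap A B * ((B * p + A * q) / (A + B))
      - A\<^sup>2 * B\<^sup>2 * (p - q)\<^sup>2 / ((A + B)\<^sup>2 * (A * p + B * q))"
    using D S unfolding overlap_def
    by (simp add: divide_simps) (simp add: power2_eq_square algebra_simps)
  \<comment> \<open>Both \<open>B\<^sup>2\<close> and \<open>A * B\<close> are at most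
    \<open>(A + B)\<^sup>2\<close>; this removes \<open>B\<close> from the loss.\<close>
  have "A * B\<^sup>2 * (p + q) = B\<^sup>2 * (A * p) + (A * B) * (B * q)"
    by (simp add: power2_eq_square algebra_simps)
  also have "\<dots> \<le> (A + B)\<^sup>2 * (A * p) + (A + B)\<^sup>2 * (B * q)"
    using assms by (intro add_mono mult_right_mono) (auto simp: power2_eq_square algebra_simps)
  finally have "A * B\<^sup>2 * (p + q) \<le> (A + B)\<^sup>2 * (A * p + B * q)"
    by (simp add: algebra_simps)
  then have "A * B\<^sup>2 / ((A + B)\<^sup>2 * (A * p + B * q)) \<le> 1 / (p + q)"
    using D S pq by (simp add: divide_simps mult.commute)
  then have "(A * (p - q)\<^sup>2) * (A * B\<^sup>2 / ((A + B)\<^sup>2 * (A * p + B * q)))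
      \<le> (A * (p - q)\<^sup>2) * (1 / (p + q))"
    using assms by (intro mult_left_mono) auto
  then show ?thesis
    unfolding eq by (simp add: power2_eq_square mult_ac)
qed

text \<open>The tangent terms for the two bit values add up to \<open>overlap A B\<close>. The two
  losses combine to a fraction with denominator
  \<open>(p + q) * (2 - p - q) = 2 * s - d\<^sup>2\<close>, which is at least
  \<open>s\<close>.\<close>

lemma overlap_split:
  assumes "0 \<le> A" "0 \<le> B" "0 \<le> p" "p \<le> 1" "0 \<le> q" "q \<le> 1"
  shows "overlap A B \<le>
    overlap (A * p) (B * q) + overlap (A * (1 - p)) (B * (1 - q)) + 2 * A * gap p q"
proof (cases "A = 0 \<or> B = 0")
  case True
  then show ?thesis
    using assms gap_bounds(1)[of p q] by (auto simp: overlap_def)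
next
  case False
  then have AB: "A > 0" "B > 0"
    using assms by auto
  let ?s = "p + q - 2 * p * q"
  let ?d = "(p - q)\<^sup>2"
  have le: "?d / (p + q) + ?d / ((1 - p) + (1 - q)) \<le> 2 * gap p q"
  proof (cases "p = q")
    case True
    then show ?thesis
      by (simp add: gap_def)
  next
    case False
    have s: "\<bar>p - q\<bar> \<le> ?s"
      using disagreement_ge assms by blast
    then have s0: "?s > 0"
      using False by linarith
    have "\<bar>p - q\<bar> * \<bar>p - q\<bar> \<le> \<bar>p - q\<bar> * 1"
      using assms by (intro mult_left_mono) auto
    then have "?d \<le> ?s"
      using s by (simp add: power2_eq_square)
    moreover have "(p + q) * (2 - p - q) = 2 * ?s - ?d"
      by (simp add: power2_eq_square algebra_simps)
    ultimately have ge: "?s \<le> (p + q) * (2 - p - q)"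
      by simp
    have pos: "p + q > 0" "2 - p - q > 0"
      using False assms by auto
    have "?d / (p + q) + ?d / ((1 - p) + (1 - q)) = 2 * ?d / ((p + q) * (2 - p - q))"
      using pos by (simp add: divide_simps) (simp add: algebra_simps)
    also have "\<dots> \<le> 2 * ?d / ?s"
      using ge s0 by (intro divide_left_mono) auto
    finally show ?thesis
      by (simp add: gap_def)
  qed
  have w: "(B * p + A * q) / (A + B) + (B * (1 - p) + A * (1 - q)) / (A + B) = 1"
    using AB by (simp add: divide_simps) (simp add: algebra_simps)
  have "overlap A B = overlap A B *
      ((B * p + A * q) / (A + B) + (B * (1 - p) + A * (1 - q)) / (A + B))"
    by (simp only: w)
  also have "\<dots> = overlap A B * ((B * p + A * q) / (A + B))
      + overlap A B * ((B * (1 - p) + A * (1 - q)) / (A + B))"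
    by (rule distrib_left)
  also have "\<dots> \<le> (overlap (A * p) (B * q) + A * (?d / (p + q)))
      + (overlap (A * (1 - p)) (B * (1 - q)) + A * (?d / ((1 - p) + (1 - q))))"
    using overlap_bit[OF AB, of p q] overlap_bit[OF AB, of "1 - p" "1 - q"] assms
    by (simp add: power2_commute)
  also have "\<dots> = overlap (A * p) (B * q) + overlap (A * (1 - p)) (B * (1 - q))
      + A * (?d / (p + q) + ?d / ((1 - p) + (1 - q)))"
    by (simp add: algebra_simps)
  also have "\<dots> \<le> overlap (A * p) (B * q) + overlap (A * (1 - p)) (B * (1 - q)) + A * (2 * gap p q)"
    using le AB by (intro add_left_mono mult_left_mono) auto
  finally show ?thesis
    by simp
qed

text \<open>\<open>Suc j\<close> is the first exponent whose power falls below \<open>x\<close>;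
  this exponent is not 0 because \<open>x \<le> 1\<close>.\<close>

lemma dyadic_bracket:
  fixes x :: real
  assumes "x \<le> 1" "(1 / 2) ^ L < x"
  obtains j where "j < L" "(1 / 2) ^ Suc j < x" "x \<le> (1 / 2) ^ j"
proof -
  define k where "k = (LEAST k. (1 / 2) ^ k < x)"
  have k: "(1 / 2) ^ k < x"
    unfolding k_def by (rule LeastI) (rule assms)
  have kL: "k \<le> L"
    unfolding k_def by (rule Least_le) (rule assms)
  from k assms(1) obtain j where j: "k = Suc j"
    by (cases k) auto
  have "\<not> (1 / 2) ^ j < x"
    using not_less_Least[of j "\<lambda>k. (1 / 2) ^ k < x"] j by (auto simp: k_def)
  then show ?thesis
    using that[of j] k kL j by auto
qed

text \<open>The log-wealth drift \<open>\<lambda>d - 2\<beta>\<^sup>2s\<close> is maximal at \<open>\<beta> = d / (4s)\<close>, and it suffices to hit this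
  optimum up to a factor of 2.\<close>

lemma dyadic_bet_exists:
  assumes "0 \<le> p" "p \<le> 1" "0 \<le> q" "q \<le> 1" "(1 / 2) ^ L < gap p q"
  obtains j l and \<sigma> :: real where "j < L" "l < L" "\<sigma> \<in> {1, -1}" "gap p q \<le> (1 / 2) ^ j"
    "(1 / 2) ^ j / 32 \<le> (\<sigma> * (1 / 2) ^ (l + 3)) * (p - q)
       - 2 * (\<sigma> * (1 / 2) ^ (l + 3))\<^sup>2 * (p + q - 2 * p * q)"
proof -
  let ?s = "p + q - 2 * p * q"
  let ?r = "\<bar>p - q\<bar> / ?s"
  obtain j where j: "j < L" "(1 / 2) ^ Suc j < gap p q" "gap p q \<le> (1 / 2) ^ j"
    using dyadic_bracket[OF gap_bounds(3)] assms by metis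
  have s: "\<bar>p - q\<bar> \<le> ?s"
    using disagreement_ge assms by blast
  have "0 < gap p q"
    using assms(5) by (smt (verit) zero_less_power half_gt_zero_iff)
  then have ne: "p \<noteq> q"
    by (auto simp: gap_def)
  then have s0: "?s > 0"
    using s by linarith
  have "?r \<le> 1"
    using s s0 by simp
  \<comment> \<open>The ratio dominates the gap, so one cutoff \<open>L\<close> serves both
    scales.\<close>
  moreover have "(1 / 2) ^ L < ?r"
    using assms(5) gap_bounds(2)[OF assms(1-4)] by linarith
  ultimately obtain l where l: "l < L" "(1 / 2) ^ Suc l < ?r" "?r \<le> (1 / 2) ^ l"
    using dyadic_bracket by metis
  \<comment> \<open>An eighth of the upper end of the bracket puts \<open>t\<close> between half the
    optimum and the optimum.\<close>
  define t :: real where "t = (1 / 2) ^ (l + 3)"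
  have tl: "4 * t = (1 / 2) ^ Suc l" "8 * t = (1 / 2) ^ l"
    by (auto simp: t_def power_add eval_nat_numeral)
  have t: "4 * t * ?s < \<bar>p - q\<bar>" "\<bar>p - q\<bar> \<le> 8 * t * ?s" "0 < t"
    using l s0 unfolding tl[symmetric] by (auto simp: field_simps t_def)
  have g: "gap p q = \<bar>p - q\<bar> * ?r"
    by (simp add: gap_def power2_eq_square)
  \<comment> \<open>The 32 collects 8 from this bound, 2 from the bracket of the gap, and 2 because
    the quadratic term may use up half of the drift.\<close>
  have "gap p q \<le> \<bar>p - q\<bar> * (8 * t)"
    unfolding g using l(3) tl by (intro mult_left_mono) auto
  then have "(1 / 2) ^ j / 32 \<le> t * \<bar>p - q\<bar> / 2"
    using j(2) by (simp add: mult_ac)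
  also have "\<dots> \<le> t * \<bar>p - q\<bar> - 2 * t\<^sup>2 * ?s"
  proof -
    have "t * (4 * t * ?s) \<le> t * \<bar>p - q\<bar>"
      using t by (intro mult_left_mono) auto
    then show ?thesis
      by (simp add: power2_eq_square algebra_simps)
  qed
  finally have fin: "(1 / 2) ^ j / 32 \<le> t * \<bar>p - q\<bar> - 2 * t\<^sup>2 * ?s" .
  show ?thesis
  proof (cases "p \<ge> q")
    case True
    then show ?thesis
      using that[of j l 1] j l fin by (simp add: t_def)
  next
    case False
    then show ?thesis
      using that[of j l "-1"] j l fin by (simp add: t_def right_diff_distrib)
  qed
qed

section \<open>Gaps at prefixes and total variation\<close>

definition prefix_prob :: "bool list pmf \<Rightarrow> bool list \<Rightarrow> real" where
  "prefix_prob p w = measure_pmf.prob p (prefix_event w)"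

text \<open>At a prefix of probability 0 the value is 0, and the bounds and product rules below
  still hold.\<close>

definition next_prob :: "bool list pmf \<Rightarrow> bool list \<Rightarrow> real" where
  "next_prob p w = prefix_prob p (w @ [True]) / prefix_prob p w"

lemma prefix_prob_nonneg [simp]: "0 \<le> prefix_prob p w"
  by (simp add: prefix_prob_def)

lemma finite_cube [simp]: "finite (cube n)"
  using finite_lists_length_eq[of "UNIV :: bool set" n] by (simp add: cube_def)

lemma cube_0: "cube 0 = {[]}"
  by (auto simp: cube_def)

lemma sum_cube_Suc:
  fixes f :: "bool list \<Rightarrow> real"
  shows "(\<Sum>w\<in>cube (Suc k). f w) = (\<Sum>w\<in>cube k. f (w @ [True]) + f (w @ [False]))"
proof -
  have "cube (Suc k) = (\<lambda>w. w @ [True]) ` cube k \<union> (\<lambda>w. w @ [False]) ` cube k"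
  proof (intro equalityI subsetI)
    fix x assume "x \<in> cube (Suc k)"
    then obtain v b where "x = v @ [b]" "v \<in> cube k"
      by (cases x rule: rev_cases) (auto simp: cube_def)
    then show "x \<in> (\<lambda>w. w @ [True]) ` cube k \<union> (\<lambda>w. w @ [False]) ` cube k"
      by (cases b) auto
  qed (auto simp: cube_def)
  then have "(\<Sum>w\<in>cube (Suc k). f w) =
      (\<Sum>w\<in>(\<lambda>w. w @ [True]) ` cube k. f w) + (\<Sum>w\<in>(\<lambda>w. w @ [False]) ` cube k. f w)"
    by (simp only:) (rule sum.union_disjoint, auto)
  also have "\<dots> = (\<Sum>w\<in>cube k. f (w @ [True])) + (\<Sum>w\<in>cube k. f (w @ [False]))"
    by (subst (1 2) sum.reindex) (auto simp: inj_on_def)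
  finally show ?thesis
    by (simp add: sum.distrib)
qed

lemma prefix_prob_split:
  assumes "set_pmf p \<subseteq> cube n" "length w < n"
  shows "prefix_prob p w = prefix_prob p (w @ [True]) + prefix_prob p (w @ [False])"
proof -
  have *: "prefix_prob p v = measure_pmf.prob p (prefix_event v \<inter> set_pmf p)" for v
    by (simp add: prefix_prob_def measure_Int_set_pmf)
  have "prefix_event w \<inter> set_pmf p =
      (prefix_event (w @ [True]) \<inter> set_pmf p) \<union> (prefix_event (w @ [False]) \<inter> set_pmf p)"
    using assms by (auto simp: prefix_event_def cube_def subset_eq take_Suc_conv_app_nth)
  moreover have "(prefix_event (w @ [True]) \<inter> set_pmf p) \<inter> (prefix_event (w @ [False]) \<inter> set_pmf p) = {}"
    by (auto simp: prefix_event_def)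
  ultimately show ?thesis
    unfolding * by (simp add: measure_pmf.finite_measure_Union)
qed

lemma next_prob:
  assumes "set_pmf p \<subseteq> cube n" "length w < n"
  shows "0 \<le> next_prob p w" "next_prob p w \<le> 1"
    "prefix_prob p (w @ [True]) = prefix_prob p w * next_prob p w"
    "prefix_prob p (w @ [False]) = prefix_prob p w * (1 - next_prob p w)"
proof -
  note s = prefix_prob_split[OF assms]
  have nn: "0 \<le> prefix_prob p w" "0 \<le> prefix_prob p (w @ [True])" "0 \<le> prefix_prob p (w @ [False])"
    by simp_all
  show "0 \<le> next_prob p w"
    by (simp add: next_prob_def)
  show "next_prob p w \<le> 1"
    unfolding next_prob_def divide_le_eq_1 using s nn by linarith
  show t: "prefix_prob p (w @ [True]) = prefix_prob p w * next_prob p w"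
    unfolding next_prob_def using s nn
    by (cases "prefix_prob p w = 0") (auto simp: add_nonneg_eq_0_iff)
  show "prefix_prob p (w @ [False]) = prefix_prob p w * (1 - next_prob p w)"
    using s t by (simp add: algebra_simps)
qed

lemma prefix_prob_full:
  assumes "set_pmf p \<subseteq> cube n" "w \<in> cube n"
  shows "prefix_prob p w = pmf p w"
proof -
  have "prefix_event w \<inter> set_pmf p = {w} \<inter> set_pmf p"
    using assms by (auto simp: prefix_event_def cube_def)
  then show ?thesis
    unfolding prefix_prob_def by (metis measure_Int_set_pmf measure_pmf_single)
qed

lemma sum_pmf_cube:
  assumes "set_pmf p \<subseteq> cube n"
  shows "(\<Sum>x\<in>cube n. pmf p x) = 1"
  using assms by (intro sum_pmf_eq_1) auto

lemma d_TV_le_1: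
  assumes "set_pmf \<tau> \<subseteq> cube n" "set_pmf \<mu> \<subseteq> cube n"
  shows "d_TV n \<tau> \<mu> \<le> 1"
proof -
  have "(\<Sum>x\<in>cube n. \<bar>pmf \<tau> x - pmf \<mu> x\<bar>) \<le> (\<Sum>x\<in>cube n. pmf \<tau> x + pmf \<mu> x)"
    by (intro sum_mono) (auto simp: abs_le_iff add_increasing add_increasing2)
  also have "\<dots> = 2"
    by (simp add: sum.distrib sum_pmf_cube[OF assms(1)] sum_pmf_cube[OF assms(2)])
  finally show ?thesis
    by (simp add: d_TV_def)
qed

definition prefix_gap :: "bool list pmf \<Rightarrow> bool list pmf \<Rightarrow> bool list \<Rightarrow> real" where
  "prefix_gap \<tau> \<mu> w = gap (next_prob \<tau> w) (next_prob \<mu> w)"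

text \<open>Expanding \<open>(\<bar>a - b\<bar> - D * (a + b))\<^sup>2 \<ge> 0\<close> replaces the
  quadratic dependence on \<open>\<bar>a - b\<bar>\<close> by a linear one, which can be summed over
  the cube.\<close>

lemma overlap_le:
  assumes "0 \<le> a" "0 \<le> b"
  shows "overlap a b \<le> (a + b) / 4 + D\<^sup>2 * (a + b) / 4 - D * \<bar>a - b\<bar> / 2"
proof (cases "a + b = 0")
  case True
  then show ?thesis
    using assms by (simp add: overlap_def add_nonneg_eq_0_iff)
next
  case False
  then have S: "a + b > 0"
    using assms by auto
  have "0 \<le> (\<bar>a - b\<bar> - D * (a + b))\<^sup>2"
    by simp
  also have "\<dots> = (a - b)\<^sup>2 - 2 * D * \<bar>a - b\<bar> * (a + b) + D\<^sup>2 * (a + b)\<^sup>2"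
    by (simp add: power2_diff power_mult_distrib)
  finally have "a * b \<le> ((a + b) / 4 + D\<^sup>2 * (a + b) / 4 - D * \<bar>a - b\<bar> / 2) * (a + b)"
    by (simp add: power2_eq_square field_simps)
  then show ?thesis
    unfolding overlap_def using S by (simp add: pos_divide_le_eq)
qed

text \<open>The overlap of the prefix distributions of length \<open>k\<close> decreases from \<open>1 / 2\<close> at \<open>k = 0\<close> to at
  most \<open>(1 - d\<^sup>2) / 2\<close> at \<open>k = n\<close>, and each step is paid for by gaps weighted with \<open>\<tau>\<close> only.\<close>

lemma d_TV_square_le_prefix_gaps:
  assumes "set_pmf \<tau> \<subseteq> cube n" "set_pmf \<mu> \<subseteq> cube n"
  shows "(d_TV n \<tau> \<mu>)\<^sup>2 / 4 \<le> (\<Sum>i<n. \<Sum>w\<in>cube i. prefix_prob \<tau> w * prefix_gap \<tau> \<mu> w)"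
proof -
  define \<Psi> where "\<Psi> k = (\<Sum>w\<in>cube k. overlap (prefix_prob \<tau> w) (prefix_prob \<mu> w))" for k
  define E where "E i = (\<Sum>w\<in>cube i. prefix_prob \<tau> w * prefix_gap \<tau> \<mu> w)" for i
  let ?D = "d_TV n \<tau> \<mu>"
  have step: "\<Psi> k \<le> \<Psi> (Suc k) + 2 * E k" if "k < n" for k
  proof -
    have "\<Psi> k \<le> (\<Sum>w\<in>cube k.
        overlap (prefix_prob \<tau> (w @ [True])) (prefix_prob \<mu> (w @ [True]))
        + overlap (prefix_prob \<tau> (w @ [False])) (prefix_prob \<mu> (w @ [False]))
        + 2 * prefix_prob \<tau> w * prefix_gap \<tau> \<mu> w)"
      unfolding \<Psi>_def
    proof (rule sum_mono)
      fix w assume "w \<in> cube k"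
      then have "length w < n"
        using that by (simp add: cube_def)
      note t = next_prob[OF assms(1) this] and m = next_prob[OF assms(2) this]
      show "overlap (prefix_prob \<tau> w) (prefix_prob \<mu> w) \<le>
        overlap (prefix_prob \<tau> (w @ [True])) (prefix_prob \<mu> (w @ [True]))
        + overlap (prefix_prob \<tau> (w @ [False])) (prefix_prob \<mu> (w @ [False]))
        + 2 * prefix_prob \<tau> w * prefix_gap \<tau> \<mu> w"
        unfolding t(3,4) m(3,4) prefix_gap_def
        by (rule overlap_split) (use t m in auto)
    qed
    also have "\<dots> = \<Psi> (Suc k) + 2 * E k"
      unfolding \<Psi>_def E_def sum_cube_Suc by (simp add: sum.distrib sum_distrib_left mult.assoc)
    finally show ?thesis .
  qed
  have "\<Psi> 0 \<le> \<Psi> k + 2 * (\<Sum>i<k. E i)" if "k \<le> n" for k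
    using that
  proof (induction k)
    case (Suc k)
    then show ?case
      using step[of k] by simp
  qed simp
  from this[of n] have "\<Psi> 0 \<le> \<Psi> n + 2 * (\<Sum>i<n. E i)"
    by simp
  moreover have "\<Psi> 0 = 1 / 2"
    by (simp add: \<Psi>_def cube_0 prefix_prob_def prefix_event_def overlap_def)
  moreover have "\<Psi> n \<le> 1 / 2 - ?D\<^sup>2 / 2"
  proof -
    have "\<Psi> n = (\<Sum>x\<in>cube n. overlap (pmf \<tau> x) (pmf \<mu> x))"
      unfolding \<Psi>_def using assms by (intro sum.cong) (auto simp: prefix_prob_full)
    \<comment> \<open>The distance itself is the optimal parameter \<open>D\<close>: the sum becomes
      \<open>1 / 2 + D\<^sup>2 / 2 - D\<^sup>2\<close>.\<close>
    also have "\<dots> \<le> (\<Sum>x\<in>cube n. (pmf \<tau> x + pmf \<mu> x) / 4 + ?D\<^sup>2 * (pmf \<tau> x + pmf \<mu> x) / 4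
        - ?D * \<bar>pmf \<tau> x - pmf \<mu> x\<bar> / 2)"
      by (intro sum_mono overlap_le) auto
    also have "\<dots> = (\<Sum>x\<in>cube n. pmf \<tau> x + pmf \<mu> x) / 4
        + ?D\<^sup>2 * (\<Sum>x\<in>cube n. pmf \<tau> x + pmf \<mu> x) / 4
        - ?D * (\<Sum>x\<in>cube n. \<bar>pmf \<tau> x - pmf \<mu> x\<bar>) / 2"
      by (simp only: sum_subtractf sum.distrib[of "\<lambda>x. (pmf \<tau> x + pmf \<mu> x) / 4"]
          sum_divide_distrib sum_distrib_left)
    also have "(\<Sum>x\<in>cube n. pmf \<tau> x + pmf \<mu> x) = 2"
      by (simp add: sum.distrib sum_pmf_cube[OF assms(1)] sum_pmf_cube[OF assms(2)])
    also have "(\<Sum>x\<in>cube n. \<bar>pmf \<tau> x - pmf \<mu> x\<bar>) = 2 * ?D"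
      by (simp add: d_TV_def)
    finally show ?thesis
      by (simp add: power2_eq_square)
  qed
  ultimately show ?thesis
    unfolding E_def by simp
qed

text \<open>For \<tau> on the cube, a prefix shorter than \<open>n\<close> has probability
  \<open>prefix_prob \<tau> w / n\<close>, so the expected gap is the sum above divided by
  \<open>n\<close>. One query at the empty prefix suffices to sample it.\<close>

definition random_prefix :: "nat \<Rightarrow> bool list pmf \<Rightarrow> bool list pmf" where
  "random_prefix n \<tau> = bind_pmf (pmf_of_set {..<n}) (\<lambda>i. map_pmf (take i) \<tau>)"

text \<open>Hence the prefix oracle never errs at a sampled prefix; only the marginal oracle
  can.\<close>

lemma set_random_prefix:
  assumes "n \<ge> 1" "set_pmf \<tau> \<subseteq> cube n" "w \<in> set_pmf (random_prefix n \<tau>)"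
  shows "length w < n" "0 < prefix_prob \<tau> w"
proof -
  have ne: "{..<n} \<noteq> {}"
    using assms(1) by (auto simp: lessThan_empty_iff)
  obtain i x where ix: "i < n" "x \<in> set_pmf \<tau>" "w = take i x"
    using assms(3) ne by (auto simp: random_prefix_def set_pmf_of_set)
  then have l: "length w = i"
    using assms(2) by (auto simp: cube_def)
  then show "length w < n"
    using ix by simp
  have "0 < pmf \<tau> x"
    using ix by (simp add: pmf_positive)
  also have "\<dots> = measure_pmf.prob \<tau> {x}"
    by (simp add: measure_pmf_single)
  also have "\<dots> \<le> prefix_prob \<tau> w"
    unfolding prefix_prob_def using ix l
    by (intro measure_pmf.finite_measure_mono) (auto simp: prefix_event_def)
  finally show "0 < prefix_prob \<tau> w" .
qed

lemma finite_random_prefix: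
  assumes "n \<ge> 1" "set_pmf \<tau> \<subseteq> cube n"
  shows "finite (set_pmf (random_prefix n \<tau>))"
proof (rule finite_subset)
  show "set_pmf (random_prefix n \<tau>) \<subseteq> (\<Union>i<n. cube i)"
    using set_random_prefix[OF assms] by (auto simp: cube_def)
qed auto

lemma expectation_prefix:
  fixes f :: "bool list \<Rightarrow> real"
  assumes "set_pmf \<tau> \<subseteq> cube n" "i < n"
  shows "measure_pmf.expectation (map_pmf (take i) \<tau>) f = (\<Sum>w\<in>cube i. prefix_prob \<tau> w * f w)"
proof -
  have "measure_pmf.expectation (map_pmf (take i) \<tau>) f =
      (\<Sum>w\<in>cube i. f w * pmf (map_pmf (take i) \<tau>) w)"
    by (rule integral_measure_pmf_real) (use assms finite_cube[of i] in \<open>auto simp: cube_def\<close>)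
  also have "\<dots> = (\<Sum>w\<in>cube i. prefix_prob \<tau> w * f w)"
    by (rule sum.cong) (auto simp: pmf_map prefix_prob_def prefix_event_def cube_def vimage_def)
  finally show ?thesis .
qed

lemma expectation_random_prefix:
  fixes f :: "bool list \<Rightarrow> real"
  assumes "n \<ge> 1" "set_pmf \<tau> \<subseteq> cube n"
  shows "measure_pmf.expectation (random_prefix n \<tau>) f =
    (\<Sum>i<n. \<Sum>w\<in>cube i. prefix_prob \<tau> w * f w) / n"
proof -
  have ne: "{..<n} \<noteq> {}"
    using assms(1) by (auto simp: lessThan_empty_iff)
  have fin: "finite (set_pmf \<tau>)"
    using assms(2) finite_subset finite_cube by blast
  have "measure_pmf.expectation (random_prefix n \<tau>) f =
      (\<Sum>i\<in>{..<n}. pmf (pmf_of_set {..<n}) i *\<^sub>R measure_pmf.expectation (map_pmf (take i) \<tau>) f)"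
    unfolding random_prefix_def
    by (rule pmf_expectation_bind) (use ne fin in auto)
  also have "\<dots> = (\<Sum>i<n. (\<Sum>w\<in>cube i. prefix_prob \<tau> w * f w) / n)"
    using expectation_prefix[OF assms(2)] ne by (intro sum.cong) auto
  finally show ?thesis
    by (simp add: sum_divide_distrib)
qed

definition next_bit :: "bool list pmf \<Rightarrow> bool list \<Rightarrow> bool pmf" where
  "next_bit p w = map_pmf (\<lambda>x. x ! length w) (cond_pmf p (prefix_event w))"

lemma pmf_next_bit_True:
  assumes "set_pmf p \<subseteq> cube n" "length w < n" "0 < prefix_prob p w"
  shows "pmf (next_bit p w) True = next_prob p w"
proof -
  have ne: "set_pmf p \<inter> prefix_event w \<noteq> {}"
    using assms(3) by (auto simp: prefix_prob_def measure_pmf_zero_iff[symmetric])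
  let ?B = "{x. x ! length w}"
  have "pmf (next_bit p w) True = measure_pmf.prob (cond_pmf p (prefix_event w)) ?B"
    by (simp add: next_bit_def pmf_map vimage_def)
  also have "\<dots> = measure_pmf.prob p (prefix_event w \<inter> ?B) / prefix_prob p w"
    unfolding cond_pmf.rep_eq[OF ne] prefix_prob_def
    using assms(3) by (intro measure_uniform_measure) (auto simp: prefix_prob_def measure_pmf.emeasure_eq_measure)
  also have "measure_pmf.prob p (prefix_event w \<inter> ?B) = prefix_prob p (w @ [True])"
  proof -
    have "(prefix_event w \<inter> ?B) \<inter> set_pmf p = prefix_event (w @ [True]) \<inter> set_pmf p"
      using assms by (auto simp: prefix_event_def cube_def subset_eq take_Suc_conv_app_nth)
    then show ?thesis
      unfolding prefix_prob_def by (metis measure_Int_set_pmf)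
  qed
  finally show ?thesis
    by (simp add: next_prob_def)
qed

lemma pmf_bool_False: "pmf p False = 1 - pmf p True"
proof -
  have "(\<Sum>b\<in>UNIV. pmf p b) = 1"
    by (rule sum_pmf_eq_1) auto
  then show ?thesis
    by (simp add: UNIV_bool)
qed

lemma pmf_bind_bool:
  fixes p :: "bool pmf"
  shows "pmf (bind_pmf p f) x = pmf p True * pmf (f True) x + (1 - pmf p True) * pmf (f False) x"
proof -
  have "pmf (bind_pmf p f) x = (\<Sum>b\<in>UNIV. pmf (f b) x * pmf p b)"
    unfolding pmf_bind by (rule integral_measure_pmf_real) auto
  then show ?thesis
    by (simp add: UNIV_bool pmf_bool_False mult.commute)
qed

section \<open>Betting at a prefix\<close>

text \<open>Rejecting on errors is safe: at a prefix sampled from \<tau> an error reveals that \<mu>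
  gives it probability 0. The wealth is compared with \<open>K\<close> only after the last round.
  The continuation \<open>c\<close> lets trials be chained.\<close>

primrec bet :: "bool list \<Rightarrow> real \<Rightarrow> real \<Rightarrow> nat \<Rightarrow> real \<Rightarrow> tester \<Rightarrow> tester" where
  "bet w \<beta> K 0 W c = (if W \<ge> K then Verdict False else c)"
| "bet w \<beta> K (Suc m) W c = Query_Prefix w (\<lambda>r. case r of None \<Rightarrow> Verdict False | Some x \<Rightarrow>
     Query_Marginal w (\<lambda>s. case s of None \<Rightarrow> Verdict False | Some b \<Rightarrow>
       bet w \<beta> K m (W * (1 + \<beta> * (of_bool (x ! length w) - of_bool b))) c))"

definition trial :: "nat \<Rightarrow> real \<Rightarrow> real \<Rightarrow> nat \<Rightarrow> tester \<Rightarrow> tester" where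
  "trial n \<beta> K m c = Random (map_pmf (\<lambda>i. Query_Prefix [] (\<lambda>r. case r of None \<Rightarrow> Verdict False
     | Some x \<Rightarrow> bet (take i x) \<beta> K m 1 c)) (pmf_of_set {..<n}))"

section \<open>Query counts of bets and trials\<close>

lemma queries_bet: "queries (bet w \<beta> K m W c) \<le> enat (2 * m) + queries c"
proof (induction m arbitrary: W)
  case (Suc m)
  have "queries (bet w \<beta> K (Suc m) W c) \<le> eSuc (eSuc (enat (2 * m) + queries c))"
    by (auto intro!: SUP_least Suc.IH simp: eSuc_ile_mono split: option.splits)
  also have "\<dots> = enat (2 * Suc m) + queries c"
    by (cases "queries c") (simp_all add: eSuc_enat)
  finally show ?case .
qed auto

lemma queries_trial: "queries (trial n \<beta> K m c) \<le> enat (1 + 2 * m) + queries c"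
proof -
  have "queries (trial n \<beta> K m c) \<le> eSuc (enat (2 * m) + queries c)"
    unfolding trial_def
    by (auto intro!: Sup_least SUP_least queries_bet simp: eSuc_ile_mono split: option.splits)
  also have "\<dots> = enat (1 + 2 * m) + queries c"
    by (cases "queries c") (simp_all add: eSuc_enat)
  finally show ?thesis .
qed

lemma queries_trial_funpow:
  "queries ((trial n \<beta> K m ^^ T) c) \<le> enat (T * (1 + 2 * m)) + queries c"
proof (induction T)
  case (Suc T)
  have "queries ((trial n \<beta> K m ^^ Suc T) c) \<le> enat (1 + 2 * m) + queries ((trial n \<beta> K m ^^ T) c)"
    using queries_trial[of n \<beta> K m "(trial n \<beta> K m ^^ T) c"] by simp
  also have "\<dots> \<le> enat (1 + 2 * m) + (enat (T * (1 + 2 * m)) + queries c)"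
    by (intro add_left_mono Suc.IH)
  also have "\<dots> = enat (Suc T * (1 + 2 * m)) + queries c"
    by (simp add: add.assoc[symmetric])
  finally show ?case .
qed (simp add: zero_enat_def[symmetric])

section \<open>Acceptance probabilities of bets and trials\<close>

definition accept :: "nat \<Rightarrow> bool list pmf \<Rightarrow> bool list pmf \<Rightarrow> tester \<Rightarrow> real" where
  "accept n \<tau> \<mu> A = pmf (run n \<tau> \<mu> A) True"

lemma accept_bounds [simp]: "0 \<le> accept n \<tau> \<mu> A" "accept n \<tau> \<mu> A \<le> 1"
  by (auto simp: accept_def pmf_le_1)

locale oracle_pair =
  fixes n :: nat and \<tau> \<mu> :: "bool list pmf"
  assumes n_pos: "n \<ge> 1"
    and supp_\<tau>: "set_pmf \<tau> \<subseteq> cube n" and supp_\<mu>: "set_pmf \<mu> \<subseteq> cube n"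
begin

abbreviation acc :: "tester \<Rightarrow> real" where "acc \<equiv> accept n \<tau> \<mu>"

abbreviation P :: "bool list \<Rightarrow> real" where "P \<equiv> next_prob \<tau>"

abbreviation Q :: "bool list \<Rightarrow> real" where "Q \<equiv> next_prob \<mu>"

lemma PQ:
  assumes "length w < n"
  shows "0 \<le> P w" "P w \<le> 1" "0 \<le> Q w" "Q w \<le> 1"
  using next_prob(1,2) assms supp_\<tau> supp_\<mu> by blast+

lemma acc_Verdict [simp]: "acc (Verdict b) = of_bool b"
  by (auto simp: accept_def)

lemma acc_bet_Suc:
  assumes "length w < n" "0 < prefix_prob \<tau> w" "0 < prefix_prob \<mu> w"
  shows "acc (bet w \<beta> K (Suc m) W c) =
    (P w * Q w + (1 - P w) * (1 - Q w)) * acc (bet w \<beta> K m W c)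
    + P w * (1 - Q w) * acc (bet w \<beta> K m (W * (1 + \<beta>)) c)
    + (1 - P w) * Q w * acc (bet w \<beta> K m (W * (1 - \<beta>)) c)"
proof -
  have "run n \<tau> \<mu> (bet w \<beta> K (Suc m) W c) =
      bind_pmf (next_bit \<tau> w) (\<lambda>a. bind_pmf (next_bit \<mu> w) (\<lambda>b.
        run n \<tau> \<mu> (bet w \<beta> K m (W * (1 + \<beta> * (of_bool a - of_bool b))) c)))"
    using assms
    by (simp add: prefix_oracle_def marginal_prefix_oracle_def prefix_prob_def next_bit_def
        bind_map_pmf)
  then show ?thesis
    using assms
    by (simp add: accept_def pmf_bind_bool pmf_next_bit_True[OF supp_\<tau>]
        pmf_next_bit_True[OF supp_\<mu>] algebra_simps)
qed

text \<open>The first round ends in rejection: if the prefix query does not err, the marginal query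
  does. With \<open>m = 0\<close> there would be no round.\<close>

lemma acc_bet_null_prefix:
  assumes "length w < n" "prefix_prob \<mu> w = 0" "m > 0"
  shows "acc (bet w \<beta> K m W c) = 0"
proof -
  obtain m' where "m = Suc m'"
    using assms(3) by (cases m) auto
  then have "run n \<tau> \<mu> (bet w \<beta> K m W c) = bind_pmf (prefix_oracle n \<tau> w) (\<lambda>r. return_pmf False)"
    by (simp only: bet.simps run.simps, intro bind_pmf_cong refl)
      (use assms in \<open>auto simp: marginal_prefix_oracle_def prefix_prob_def bind_return_pmf
        split: option.split\<close>)
  then show ?thesis
    by (simp add: accept_def)
qed

text \<open>The continuation is reached exactly when the bet does not reject, and it uses fresh
  answers. This makes the acceptance probabilities of chained trials multiply.\<close>

lemma acc_bet_continue:
  assumes "length w < n" "0 < prefix_prob \<tau> w"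
  shows "acc (bet w \<beta> K m W c) = acc (bet w \<beta> K m W (Verdict True)) * acc c"
proof (cases "prefix_prob \<mu> w = 0")
  case True
  then show ?thesis
    using acc_bet_null_prefix[OF assms(1) True, of m] by (cases m) (auto simp del: bet.simps(2))
next
  case False
  then have "0 < prefix_prob \<mu> w"
    by (simp add: less_le)
  note rec = acc_bet_Suc[OF assms this]
  show ?thesis
    by (induction m arbitrary: W) (auto simp: rec algebra_simps simp del: bet.simps(2))
qed

text \<open>Under the null hypothesis the wealth is a martingale, so the rejection probability is bounded
  by Markov's inequality.\<close>

lemma acc_bet_null:
  assumes eq: "\<tau> = \<mu>" and w: "length w < n" "0 < prefix_prob \<tau> w" and "0 < K" "0 \<le> W" "\<bar>\<beta>\<bar> \<le> 1"
  shows "1 - W / K \<le> acc (bet w \<beta> K m W (Verdict True))"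
  using \<open>0 \<le> W\<close>
proof (induction m arbitrary: W)
  case 0
  then show ?case
    using \<open>0 < K\<close> by (auto simp: field_simps)
next
  case (Suc m)
  have "0 < prefix_prob \<mu> w"
    using w eq by simp
  note rec = acc_bet_Suc[OF w this] and pq = PQ[OF w(1)]
  have QP: "Q w = P w"
    using eq by simp
  have nn: "0 \<le> W * (1 + \<beta>)" "0 \<le> W * (1 - \<beta>)"
    using Suc.prems \<open>\<bar>\<beta>\<bar> \<le> 1\<close> by auto
  \<comment> \<open>Winning and losing are equally likely when \<open>P w = Q w\<close>, so the
    expected wealth after the round is again \<open>W\<close>.\<close>
  have "1 - W / K = (P w * Q w + (1 - P w) * (1 - Q w)) * (1 - W / K)
      + P w * (1 - Q w) * (1 - W * (1 + \<beta>) / K) + (1 - P w) * Q w * (1 - W * (1 - \<beta>) / K)"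
    unfolding QP using \<open>0 < K\<close> by (simp add: field_simps)
  also have "\<dots> \<le> acc (bet w \<beta> K (Suc m) W (Verdict True))"
    unfolding rec using pq nn Suc by (intro add_mono mult_left_mono Suc.IH) auto
  finally show ?case .
qed

text \<open>Under the alternative Markov's inequality is applied to the inverse wealth.\<close>

lemma acc_bet_alternative:
  assumes w: "length w < n" "0 < prefix_prob \<tau> w" "0 < prefix_prob \<mu> w"
    and "0 < K" "0 < W" and l: "\<bar>\<beta>\<bar> \<le> 1 / 2"
  shows "acc (bet w \<beta> K m W (Verdict True)) \<le>
    K / W * (1 - \<beta> * (P w - Q w) + 2 * \<beta>\<^sup>2 * (P w + Q w - 2 * P w * Q w)) ^ m"
  using \<open>0 < W\<close>
proof (induction m arbitrary: W)
  case 0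
  then show ?case
    using \<open>0 < K\<close> by (auto simp: field_simps)
next
  case (Suc m)
  note rec = acc_bet_Suc[OF w] and pq = PQ[OF w(1)]
  let ?\<rho> = "1 - \<beta> * (P w - Q w) + 2 * \<beta>\<^sup>2 * (P w + Q w - 2 * P w * Q w)"
  \<comment> \<open>Multiplied out, the right-hand side times \<open>1 + y\<close> is
    \<open>1 + y\<^sup>2 * (1 + 2 * y)\<close>; this is where
    \<open>\<bar>\<beta>\<bar> \<le> 1 / 2\<close> enters.\<close>
  have inv: "1 / (1 + y) \<le> 1 - y + 2 * y\<^sup>2" if "\<bar>y\<bar> \<le> 1 / 2" for y :: real
  proof -
    have "0 \<le> y\<^sup>2 * (1 + 2 * y)"
      using that by (intro mult_nonneg_nonneg) auto
    then have "1 \<le> (1 - y + 2 * y\<^sup>2) * (1 + y)"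
      by (simp add: power2_eq_square algebra_simps)
    then show ?thesis
      using that by (simp add: divide_le_eq abs_le_iff)
  qed
  have inv2: "1 / (1 + \<beta>) \<le> 1 - \<beta> + 2 * \<beta>\<^sup>2" "1 / (1 - \<beta>) \<le> 1 + \<beta> + 2 * \<beta>\<^sup>2"
    using inv[of \<beta>] inv[of "-\<beta>"] l by auto
  have s: "0 \<le> P w * (1 - Q w)" "0 \<le> (1 - P w) * Q w" "0 \<le> P w * Q w + (1 - P w) * (1 - Q w)"
    using pq by auto
  \<comment> \<open>The expected factor by which one round changes the inverse wealth.\<close>
  let ?E = "(P w * Q w + (1 - P w) * (1 - Q w))
      + P w * (1 - Q w) * (1 / (1 + \<beta>)) + (1 - P w) * Q w * (1 / (1 - \<beta>))"
  have "?E \<le> (P w * Q w + (1 - P w) * (1 - Q w))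
      + P w * (1 - Q w) * (1 - \<beta> + 2 * \<beta>\<^sup>2) + (1 - P w) * Q w * (1 + \<beta> + 2 * \<beta>\<^sup>2)"
    by (intro add_mono mult_left_mono order_refl inv2 s)
  also have "\<dots> = ?\<rho>"
    by (simp add: algebra_simps)
  finally have E: "?E \<le> ?\<rho>" .
  have pos: "0 < 1 + \<beta>" "0 < 1 - \<beta>"
    using l by (auto simp: abs_le_iff)
  have "0 \<le> ?E"
    by (intro add_nonneg_nonneg[OF add_nonneg_nonneg[OF s(3)]] mult_nonneg_nonneg[OF s(1)]
        mult_nonneg_nonneg[OF s(2)]) (use pos in auto)
  then have \<rho>: "0 \<le> ?\<rho>"
    using E by linarith
  have "acc (bet w \<beta> K (Suc m) W (Verdict True)) \<le>
      (P w * Q w + (1 - P w) * (1 - Q w)) * (K / W * ?\<rho> ^ m)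
      + P w * (1 - Q w) * (K / (W * (1 + \<beta>)) * ?\<rho> ^ m)
      + (1 - P w) * Q w * (K / (W * (1 - \<beta>)) * ?\<rho> ^ m)"
    unfolding rec by (intro add_mono mult_left_mono Suc.IH s mult_pos_pos Suc.prems pos)
  also have "\<dots> = (K / W * ?\<rho> ^ m) * ?E"
  proof -
    have "X * (k * R) + Y * (k * a * R) + Z * (k * b * R) = (k * R) * (X + Y * a + Z * b)"
      for X Y Z k R a b :: real
      by (simp add: algebra_simps)
    moreover have "K / (W * (1 + \<beta>)) = K / W * (1 / (1 + \<beta>))" "K / (W * (1 - \<beta>)) = K / W * (1 / (1 - \<beta>))"
      by simp_all
    ultimately show ?thesis
      by (simp only:)
  qed
  also have "\<dots> \<le> (K / W * ?\<rho> ^ m) * ?\<rho>"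
    using E \<rho> \<open>0 < K\<close> Suc.prems by (intro mult_left_mono mult_nonneg_nonneg) auto
  finally show ?case
    by (simp add: mult_ac)
qed

definition pass :: "real \<Rightarrow> real \<Rightarrow> nat \<Rightarrow> real" where
  "pass \<beta> K m = measure_pmf.expectation (random_prefix n \<tau>)
     (\<lambda>w. acc (bet w \<beta> K m 1 (Verdict True)))"

lemma pass_bounds: "0 \<le> pass \<beta> K m" "pass \<beta> K m \<le> 1"
proof -
  show "0 \<le> pass \<beta> K m"
    unfolding pass_def by (intro Bochner_Integration.integral_nonneg) auto
  show "pass \<beta> K m \<le> 1"
    unfolding pass_def by (intro measure_pmf.integral_le_const
        integrable_measure_pmf_finite finite_random_prefix n_pos supp_\<tau>) auto
qed

lemma acc_trial: "acc (trial n \<beta> K m c) = pass \<beta> K m * acc c"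
proof -
  have 1: "0 < n" "prefix_event [] = UNIV"
    using n_pos by (auto simp: prefix_event_def)
  have 2: "cond_pmf \<tau> UNIV = \<tau>"
    by (rule pmf_eqI) (simp add: pmf_cond set_pmf_not_empty)
  have "run n \<tau> \<mu> (trial n \<beta> K m c) =
      bind_pmf (random_prefix n \<tau>) (\<lambda>w. run n \<tau> \<mu> (bet w \<beta> K m 1 c))"
    unfolding trial_def random_prefix_def
    by (simp add: 1 2 prefix_oracle_def bind_map_pmf bind_assoc_pmf bind_return_pmf
        join_pmf_def map_pmf_comp)
  then have "acc (trial n \<beta> K m c) =
      measure_pmf.expectation (random_prefix n \<tau>) (\<lambda>w. acc (bet w \<beta> K m 1 c))"
    by (simp add: accept_def pmf_bind)
  also have "\<dots> = measure_pmf.expectation (random_prefix n \<tau>)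
      (\<lambda>w. acc (bet w \<beta> K m 1 (Verdict True)) * acc c)"
    by (intro integral_cong_AE)
      (auto simp: AE_measure_pmf_iff intro!: acc_bet_continue set_random_prefix[OF n_pos supp_\<tau>])
  finally show ?thesis
    by (simp add: pass_def)
qed

lemma acc_trial_funpow: "acc ((trial n \<beta> K m ^^ T) c) = pass \<beta> K m ^ T * acc c"
  by (induction T) (simp_all add: acc_trial)

lemma pass_null:
  assumes "\<tau> = \<mu>" "0 < K" "\<bar>\<beta>\<bar> \<le> 1"
  shows "1 - 1 / K \<le> pass \<beta> K m"
proof -
  have "1 - 1 / K \<le> acc (bet w \<beta> K m 1 (Verdict True))" if "w \<in> set_pmf (random_prefix n \<tau>)" for w
    using acc_bet_null[OF assms(1) set_random_prefix[OF n_pos supp_\<tau> that] assms(2) _ assms(3)]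
    by simp
  then show ?thesis
    unfolding pass_def by (intro measure_pmf.integral_ge_const integrable_measure_pmf_finite
        finite_random_prefix n_pos supp_\<tau>) (auto simp: AE_measure_pmf_iff)
qed

text \<open>At these prefixes each round multiplies the bound on the expected inverse wealth by at
  most \<open>1 - (1 / 2) ^ j / 32\<close>; the constant is that of
  \<open>dyadic_bet_exists\<close>.\<close>

definition good :: "nat \<Rightarrow> real \<Rightarrow> bool list set" where
  "good j \<beta> = {w. (1 / 2) ^ j / 32 \<le>
     \<beta> * (P w - Q w) - 2 * \<beta>\<^sup>2 * (P w + Q w - 2 * P w * Q w)}"

text \<open>At a good prefix \<open>m\<close> rounds push the acceptance probability down to
  \<open>1 / 2\<close>, or to 0 if \<mu> gives the prefix probability 0; elsewhere it is bounded by
  1.\<close>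

lemma pass_alternative:
  assumes "\<bar>\<beta>\<bar> \<le> 1 / 2" "0 < K" "0 < m" "2 * K \<le> exp ((1 / 2) ^ j / 32 * m)"
  shows "pass \<beta> K m \<le> 1 - measure_pmf.prob (random_prefix n \<tau>) (good j \<beta>) / 2"
proof -
  let ?D = "random_prefix n \<tau>"
  have le: "acc (bet w \<beta> K m 1 (Verdict True)) \<le> 1 - indicator (good j \<beta>) w / 2"
    if "w \<in> set_pmf ?D" for w
  proof -
    note w = set_random_prefix[OF n_pos supp_\<tau> that]
    show ?thesis
    proof (cases "w \<in> good j \<beta>")
      case False
      then show ?thesis
        by simp
    next
      case good: True
      show ?thesis
      proof (cases "prefix_prob \<mu> w = 0")
        case True
        then show ?thesis
          using acc_bet_null_prefix[OF w(1) True assms(3)] good by simp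
      next
        case False
        then have \<mu>w: "0 < prefix_prob \<mu> w"
          by (simp add: less_le)
        let ?\<rho> = "1 - \<beta> * (P w - Q w) + 2 * \<beta>\<^sup>2 * (P w + Q w - 2 * P w * Q w)"
        have "1 - \<beta> * (P w - Q w) \<ge> 0"
        proof -
          have "\<bar>\<beta> * (P w - Q w)\<bar> \<le> 1 / 2 * 1"
            unfolding abs_mult using assms(1) PQ[OF w(1)] by (intro mult_mono) auto
          then show ?thesis
            by (simp add: abs_le_iff)
        qed
        moreover have "0 \<le> P w + Q w - 2 * P w * Q w"
          using disagreement_ge[OF PQ[OF w(1)]] by linarith
        ultimately have \<rho>0: "0 \<le> ?\<rho>"
          by simp
        have "?\<rho> \<le> 1 + - ((1 / 2) ^ j / 32)"
          using good by (simp add: good_def)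
        also have "\<dots> \<le> exp (- ((1 / 2) ^ j / 32))"
          by (rule exp_ge_add_one_self)
        finally have "?\<rho> ^ m \<le> exp (- ((1 / 2) ^ j / 32)) ^ m"
          using \<rho>0 by (intro power_mono)
        also have "\<dots> = 1 / exp ((1 / 2) ^ j / 32 * m)"
          by (simp only: exp_of_nat_mult[symmetric])
            (simp add: exp_minus inverse_eq_divide mult.commute)
        also have "\<dots> \<le> 1 / (2 * K)"
          using assms by (intro divide_left_mono) auto
        finally have "K * ?\<rho> ^ m \<le> K * (1 / (2 * K))"
          using assms(2) by (intro mult_left_mono) auto
        moreover have "acc (bet w \<beta> K m 1 (Verdict True)) \<le> K / 1 * ?\<rho> ^ m"
          by (rule acc_bet_alternative) (use w \<mu>w assms in auto)
        ultimately show ?thesis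
          using good assms(2) by simp
      qed
    qed
  qed
  note int = integrable_measure_pmf_finite[OF finite_random_prefix[OF n_pos supp_\<tau>]]
  have "pass \<beta> K m \<le> measure_pmf.expectation ?D (\<lambda>w. 1 - indicator (good j \<beta>) w / 2)"
    unfolding pass_def by (intro integral_mono_AE int) (auto simp: AE_measure_pmf_iff le)
  also have "\<dots> = 1 - measure_pmf.prob ?D (good j \<beta>) / 2"
    by (subst Bochner_Integration.integral_diff) (auto simp: int)
  finally show ?thesis .
qed

end

section \<open>The tester\<close>

text \<open>The values of \<open>\<sigma> * (1 / 2) ^ (l + 3)\<close> in
  \<open>dyadic_bet_exists\<close>, with both signs because the sign of \<open>p - q\<close> is
  unknown.\<close>

definition fractions :: "nat \<Rightarrow> real list" where
  "fractions L = map (\<lambda>l. (1 / 2) ^ (l + 3)) [0..<L] @ map (\<lambda>l. - ((1 / 2) ^ (l + 3))) [0..<L]"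

definition grid :: "nat \<Rightarrow> (nat \<times> real) list" where
  "grid L = List.product [0..<L] (fractions L)"

text \<open>For some level \<open>j\<close> a fraction of about \<open>2\<^sup>j\<^sup>-\<^sup>L\<close> of the prefixes has gap about \<open>2\<^sup>-\<^sup>j\<close>: this takes about
  \<open>2\<^sup>L\<^sup>-\<^sup>j\<close> trials with about \<open>2\<^sup>j\<close> rounds each, so that every level costs about \<open>2\<^sup>L\<close> queries.\<close>

definition stage :: "nat \<Rightarrow> nat \<Rightarrow> nat \<times> real \<Rightarrow> tester \<Rightarrow> tester" where
  "stage n L = (\<lambda>(j, \<beta>). trial n \<beta> (2 ^ (11 * L)) (384 * L * 2 ^ j) ^^ (8 * L\<^sup>2 * 2 ^ (L - j)))"

definition betting_tester :: "nat \<Rightarrow> nat \<Rightarrow> tester" where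
  "betting_tester n L = foldr (stage n L) (grid L) (Verdict True)"

lemma length_grid: "length (grid L) = 2 * L\<^sup>2"
  by (simp add: grid_def fractions_def power2_eq_square)

lemma mem_grid_D:
  assumes "(j, \<beta>) \<in> set (grid L)"
  shows "j < L" "\<bar>\<beta>\<bar> \<le> 1 / 2"
proof -
  have "(1 / 2 :: real) ^ (l + 3) \<le> 1 / 2" for l
    using power_decreasing[of 1 "l + 3" "1 / 2 :: real"] by simp
  then show "j < L" "\<bar>\<beta>\<bar> \<le> 1 / 2"
    using assms by (auto simp: grid_def fractions_def)
qed

lemma mem_grid_I:
  assumes "j < L" "l < L" "\<sigma> \<in> {1, -1}"
  shows "(j, \<sigma> * (1 / 2) ^ (l + 3)) \<in> set (grid L)"
  using assms by (auto simp: grid_def fractions_def)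

lemma queries_stage:
  assumes "j < L"
  shows "queries (stage n L (j, \<beta>) c) \<le> enat (6152 * L ^ 3 * 2 ^ L) + queries c"
proof -
  have p: "2 ^ (L - j) * 2 ^ j = (2 :: nat) ^ L"
    using assms by (simp flip: power_add)
  \<comment> \<open>The single query per trial that draws the prefix is absorbed into the cost of
    the rounds, turning 768 into 769.\<close>
  have "1 * (2 :: nat) ^ (L - j) \<le> L * 2 ^ L"
    using assms by (intro mult_mono power_increasing) auto
  then have "8 * L\<^sup>2 * (2 ^ (L - j) + 768 * L * 2 ^ L) \<le> 8 * L\<^sup>2 * (769 * L * 2 ^ L)"
    by (intro mult_left_mono) auto
  moreover have "8 * L\<^sup>2 * 2 ^ (L - j) * (1 + 2 * (384 * L * 2 ^ j))
      = 8 * L\<^sup>2 * (2 ^ (L - j) + 768 * L * 2 ^ L)"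
    unfolding p[symmetric] by (simp add: algebra_simps)
  ultimately have "8 * L\<^sup>2 * 2 ^ (L - j) * (1 + 2 * (384 * L * 2 ^ j)) \<le> 6152 * L ^ 3 * 2 ^ L"
    by (simp add: power2_eq_square power3_eq_cube)
  then have "enat (8 * L\<^sup>2 * 2 ^ (L - j) * (1 + 2 * (384 * L * 2 ^ j))) + queries c
      \<le> enat (6152 * L ^ 3 * 2 ^ L) + queries c"
    by (intro add_right_mono) simp
  then show ?thesis
    unfolding stage_def prod.case using queries_trial_funpow order_trans by blast
qed

lemma queries_betting_tester: "queries (betting_tester n L) \<le> enat (12304 * L ^ 5 * 2 ^ L)"
proof -
  have "queries (foldr (stage n L) gs (Verdict True)) \<le> enat (length gs * (6152 * L ^ 3 * 2 ^ L))"
    if "set gs \<subseteq> set (grid L)" for gs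
    using that
  proof (induction gs)
    case (Cons g gs)
    obtain j \<beta> where g: "g = (j, \<beta>)"
      by (cases g)
    have "j < L"
      using Cons.prems g mem_grid_D(1) by auto
    then have "queries (foldr (stage n L) (g # gs) (Verdict True)) \<le>
        enat (6152 * L ^ 3 * 2 ^ L) + queries (foldr (stage n L) gs (Verdict True))"
      using queries_stage by (simp add: g)
    also have "\<dots> \<le> enat (6152 * L ^ 3 * 2 ^ L) + enat (length gs * (6152 * L ^ 3 * 2 ^ L))"
      using Cons by (intro add_left_mono) auto
    finally show ?case
      by simp
  qed (simp add: zero_enat_def)
  then have "queries (betting_tester n L) \<le> enat (2 * L\<^sup>2 * (6152 * L ^ 3 * 2 ^ L))"
    unfolding betting_tester_def length_grid[symmetric] by blast
  also have "2 * L\<^sup>2 * (6152 * L ^ 3 * 2 ^ L) = 12304 * (L\<^sup>2 * L ^ 3) * 2 ^ L"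
    by simp
  also have "L\<^sup>2 * L ^ 3 = L ^ 5"
    by (simp flip: power_add)
  finally show ?thesis .
qed

section \<open>Error probabilities of the tester\<close>

context oracle_pair
begin

definition survive :: "nat \<Rightarrow> nat \<times> real \<Rightarrow> real" where
  "survive L = (\<lambda>(j, \<beta>). pass \<beta> (2 ^ (11 * L)) (384 * L * 2 ^ j) ^ (8 * L\<^sup>2 * 2 ^ (L - j)))"

lemma survive_bounds: "0 \<le> survive L g" "survive L g \<le> 1"
  by (auto simp: survive_def pass_bounds power_le_one split: prod.splits)

lemma acc_stage: "acc (stage n L g c) = survive L g * acc c"
  by (auto simp: stage_def survive_def acc_trial_funpow split: prod.splits)

text \<open>A union bound over the stages, in the form \<open>a * r \<ge> a + r - 1\<close> for
  \<open>a\<close> and \<open>r\<close> at most 1.\<close>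

lemma acc_foldr_stage_ge:
  fixes e :: real
  assumes "\<And>g. g \<in> set gs \<Longrightarrow> 1 - e \<le> survive L g"
  shows "1 - length gs * e \<le> acc (foldr (stage n L) gs (Verdict True))"
  using assms
proof (induction gs)
  case (Cons g gs)
  let ?r = "acc (foldr (stage n L) gs (Verdict True))"
  have "0 \<le> (1 - survive L g) * (1 - ?r)"
    using survive_bounds by (intro mult_nonneg_nonneg) auto
  moreover have "1 - length gs * e \<le> ?r" "1 - e \<le> survive L g"
    using Cons by auto
  ultimately show ?case
    by (simp add: acc_stage algebra_simps)
qed simp

lemma acc_foldr_stage_le:
  assumes "g \<in> set gs"
  shows "acc (foldr (stage n L) gs (Verdict True)) \<le> survive L g"
  using assms
proof (induction gs)
  case (Cons h gs)
  let ?r = "acc (foldr (stage n L) gs (Verdict True))"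
  show ?case
  proof (cases "g = h")
    case True
    have "survive L h * ?r \<le> survive L h * 1"
      using survive_bounds by (intro mult_left_mono) auto
    then show ?thesis
      using True by (simp add: acc_stage)
  next
    case False
    have "survive L h * ?r \<le> 1 * ?r"
      using survive_bounds by (intro mult_right_mono) auto
    then show ?thesis
      using Cons False by (simp add: acc_stage)
  qed
qed simp

text \<open>A union bound over at most \<open>16 * L ^ 4 * 2 ^ L\<close> trials, each rejecting with
  probability at most \<open>1 / ?K\<close>. The exponent \<open>11 * L\<close> is
  \<open>6 * L\<close> for the constant 48, \<open>4 * L\<close> for \<open>L ^ 4\<close> and
  \<open>L\<close> for \<open>2 ^ L\<close>.\<close>

lemma betting_tester_complete:
  assumes "\<tau> = \<mu>" "1 \<le> L"
  shows "2 / 3 \<le> acc (betting_tester n L)"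
proof -
  let ?K = "2 ^ (11 * L) :: real"
  let ?e = "8 * (real L)\<^sup>2 * 2 ^ L / ?K"
  have "1 - ?e \<le> survive L g" if "g \<in> set (grid L)" for g
  proof -
    obtain j \<beta> where g: "g = (j, \<beta>)"
      by (cases g)
    define T where "T = 8 * L\<^sup>2 * 2 ^ (L - j)"
    have b: "\<bar>\<beta>\<bar> \<le> 1"
      using mem_grid_D(2) that g by fastforce
    have "(2 :: real) ^ (L - j) \<le> 2 ^ L"
      by (intro power_increasing) auto
    then have "real T \<le> 8 * (real L)\<^sup>2 * 2 ^ L"
      unfolding T_def by (simp add: mult_left_mono)
    then have "1 - ?e \<le> 1 + real T * (- 1 / ?K)"
      by (simp add: divide_right_mono)
    also have "\<dots> \<le> (1 + - 1 / ?K) ^ T"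
      by (rule Bernoulli_inequality) auto
    also have "\<dots> \<le> pass \<beta> ?K (384 * L * 2 ^ j) ^ T"
      using pass_null[OF assms(1) _ b, of ?K] by (intro power_mono) auto
    finally show ?thesis
      by (simp add: g survive_def T_def)
  qed
  then have "1 - length (grid L) * ?e \<le> acc (betting_tester n L)"
    unfolding betting_tester_def by (rule acc_foldr_stage_ge)
  moreover have "length (grid L) * ?e \<le> 1 / 3"
  proof -
    have "real L \<le> 2 ^ L"
      using of_nat_less_two_power[of L, where 'a = real] by linarith
    then have "(real L) ^ 4 \<le> (2 ^ L) ^ 4"
      by (intro power_mono) auto
    moreover have "(48 :: real) \<le> 2 ^ (6 * L)"
      using power_increasing[of 6 "6 * L" "2 :: real"] assms(2) by simp
    ultimately have "48 * ((real L) ^ 4 * 2 ^ L) \<le> 2 ^ (6 * L) * ((2 ^ L) ^ 4 * 2 ^ L)"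
      by (intro mult_mono) auto
    also have "\<dots> = ?K"
      by (simp flip: power_add power_mult)
    finally have "3 * (16 * (real L) ^ 4 * 2 ^ L) \<le> ?K"
      by simp
    then have "16 * (real L) ^ 4 * 2 ^ L / ?K \<le> 1 / 3"
      by (simp add: divide_le_eq)
    moreover have "length (grid L) * ?e = 16 * (real L) ^ 4 * 2 ^ L / ?K"
      unfolding length_grid by (simp add: power2_eq_square power4_eq_xxxx mult_ac)
    ultimately show ?thesis
      by (simp only:)
  qed
  ultimately show ?thesis
    by linarith
qed

text \<open>Pigeonhole over the grid: at every sampled prefix the gap is at most the cutoff plus the
  contributions of the grid points good for it. If all \<open>2 * L\<^sup>2\<close> expected
  contributions were small, the expected gap could not exceed twice the cutoff.\<close>

lemma exists_good_bet:
  assumes "2 * (1 / 2) ^ L < measure_pmf.expectation (random_prefix n \<tau>) (prefix_gap \<tau> \<mu>)"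
    and "1 \<le> L"
  shows "\<exists>g\<in>set (grid L). (1 / 2) ^ L / (2 * (real L)\<^sup>2) \<le>
    (1 / 2) ^ fst g * measure_pmf.prob (random_prefix n \<tau>) (good (fst g) (snd g))"
proof (rule ccontr)
  assume no: "\<not> ?thesis"
  let ?D = "random_prefix n \<tau>"
  let ?e = "(1 / 2) ^ L / (2 * (real L)\<^sup>2)"
  let ?h = "\<lambda>g. (1 / 2) ^ fst g * measure_pmf.prob ?D (good (fst g) (snd g))"
  have small: "?h g \<le> ?e" if "g \<in> set (grid L)" for g
    using that no by (meson linear)
  note int = integrable_measure_pmf_finite[OF finite_random_prefix[OF n_pos supp_\<tau>]]
  let ?u = "\<lambda>w. (1 / 2) ^ L + (\<Sum>g\<in>set (grid L).
      (1 / 2) ^ fst g * indicator (good (fst g) (snd g)) w :: real)"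
  have le: "prefix_gap \<tau> \<mu> w \<le> ?u w" if "w \<in> set_pmf ?D" for w
  proof (cases "(1 / 2) ^ L < prefix_gap \<tau> \<mu> w")
    case True
    have "length w < n"
      using set_random_prefix[OF n_pos supp_\<tau> that] by simp
    from dyadic_bet_exists[OF PQ[OF this], of L] True
    obtain j l \<sigma> where jl: "j < L" "l < L" "\<sigma> \<in> {1, -1}" "prefix_gap \<tau> \<mu> w \<le> (1 / 2) ^ j"
      and good: "w \<in> good j (\<sigma> * (1 / 2) ^ (l + 3))"
      unfolding prefix_gap_def good_def mem_Collect_eq by metis
    let ?g = "(j, \<sigma> * (1 / 2) ^ (l + 3))"
    have "prefix_gap \<tau> \<mu> w \<le> (1 / 2) ^ fst ?g * indicator (good (fst ?g) (snd ?g)) w"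
      using jl good by simp
    also have "\<dots> \<le> (\<Sum>g\<in>set (grid L). (1 / 2) ^ fst g * indicator (good (fst g) (snd g)) w)"
      by (rule member_le_sum[OF mem_grid_I[OF jl(1-3)]]) auto
    finally show ?thesis
      by (simp add: add_increasing)
  next
    case False
    have "0 \<le> (\<Sum>g\<in>set (grid L). (1 / 2) ^ fst g * indicator (good (fst g) (snd g)) w :: real)"
      by (intro sum_nonneg) auto
    then show ?thesis
      using False by linarith
  qed
  have "measure_pmf.expectation ?D (prefix_gap \<tau> \<mu>) \<le> measure_pmf.expectation ?D ?u"
    by (intro integral_mono_AE int) (simp only: AE_measure_pmf_iff, intro ballI le)
  also have "\<dots> = (1 / 2) ^ L + (\<Sum>g\<in>set (grid L). ?h g)"
    by (subst Bochner_Integration.integral_add, (intro int)+,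
        subst Bochner_Integration.integral_sum, intro int) simp
  also have "(\<Sum>g\<in>set (grid L). ?h g) \<le> of_nat (card (set (grid L))) * ?e"
    by (rule sum_bounded_above) (rule small)
  also have "\<dots> \<le> of_nat (2 * L\<^sup>2) * ?e"
    using card_length[of "grid L"]
    by (intro mult_right_mono of_nat_mono) (auto simp only: length_grid, simp)
  also have "\<dots> = (1 / 2) ^ L"
    using assms(2) by simp
  finally show False
    using assms(1) by simp
qed

lemma betting_tester_sound:
  assumes "d_TV n \<tau> \<mu> > \<epsilon>" "\<epsilon> > 0" "8 * real n / \<epsilon>\<^sup>2 \<le> 2 ^ L" "1 \<le> L"
  shows "acc (betting_tester n L) \<le> 1 / 3"
proof -
  let ?D = "random_prefix n \<tau>"
  have n0: "real n > 0"
    using n_pos by simp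
  have "\<epsilon>\<^sup>2 < (d_TV n \<tau> \<mu>)\<^sup>2"
    using assms by (intro power_strict_mono) auto
  then have "\<epsilon>\<^sup>2 / 4 / n < (d_TV n \<tau> \<mu>)\<^sup>2 / 4 / n"
    using n0 by (intro divide_strict_right_mono) auto
  also have "\<dots> \<le> measure_pmf.expectation ?D (prefix_gap \<tau> \<mu>)"
    unfolding expectation_random_prefix[OF n_pos supp_\<tau>]
    by (intro divide_right_mono d_TV_square_le_prefix_gaps supp_\<tau> supp_\<mu>) auto
  finally have "\<epsilon>\<^sup>2 / 4 / n < measure_pmf.expectation ?D (prefix_gap \<tau> \<mu>)" .
  \<comment> \<open>The 8 in the hypothesis on \<open>L\<close> is this 2 times the 4 from the total
    variation bound.\<close>
  moreover have "2 * (1 / 2) ^ L \<le> \<epsilon>\<^sup>2 / 4 / n"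
    using assms(2,3) n0 by (simp add: power_one_over field_simps)
  ultimately have "2 * (1 / 2) ^ L < measure_pmf.expectation ?D (prefix_gap \<tau> \<mu>)"
    by linarith
  then obtain j \<beta> where g: "(j, \<beta>) \<in> set (grid L)" and
    pr: "(1 / 2) ^ L / (2 * (real L)\<^sup>2) \<le> (1 / 2) ^ j * measure_pmf.prob ?D (good j \<beta>)"
    using exists_good_bet assms(4) by (metis prod.collapse)
  have j: "j < L"
    using mem_grid_D g by blast
  define K :: real where "K = 2 ^ (11 * L)"
  define m where "m = 384 * L * 2 ^ j"
  define T where "T = 8 * L\<^sup>2 * 2 ^ (L - j)"
  \<comment> \<open>The good prefixes have probability at least \<open>4 / T\<close>, and a trial
    rejects at them with probability at least \<open>1 / 2\<close>, hence at least
    \<open>2 / T\<close> overall.\<close>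
  define x :: real where "x = 2 / T"
  have T0: "T > 0"
    using assms(4) by (simp add: T_def)
  have L0: "real L > 0"
    using assms(4) by simp
  have p: "(2 :: real) ^ L = 2 ^ (L - j) * 2 ^ j"
    using j by (simp flip: power_add)
  have x: "x \<le> measure_pmf.prob ?D (good j \<beta>) / 2"
    using pr L0 unfolding x_def T_def by (simp add: power_one_over p field_simps)
  have "2 * K \<le> 2 ^ (12 * L)"
  proof -
    have "2 * K = 2 ^ (1 + 11 * L)"
      by (simp add: K_def)
    also have "\<dots> \<le> (2 :: real) ^ (12 * L)"
      using assms(4) by (intro power_increasing) auto
    finally show ?thesis .
  qed
  also have "\<dots> \<le> exp 1 ^ (12 * L)"
    using exp_ge_add_one_self[of 1] by (intro power_mono) auto
  \<comment> \<open>The 384 is \<open>12 * 32\<close>: the exponent \<open>12 * L\<close> beats the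
    threshold \<open>2 ^ (11 * L)\<close> and the extra factor 2.\<close>
  also have "\<dots> = exp ((1 / 2) ^ j / 32 * m)"
    by (simp add: m_def exp_of_nat_mult[symmetric] power_one_over)
  finally have K: "2 * K \<le> exp ((1 / 2) ^ j / 32 * m)" .
  have "pass \<beta> K m \<le> 1 - measure_pmf.prob ?D (good j \<beta>) / 2"
    using mem_grid_D(2)[OF g] K assms(4) by (intro pass_alternative) (auto simp: K_def m_def)
  also have "\<dots> \<le> 1 + - x"
    using x by simp
  also have "\<dots> \<le> exp (- x)"
    by (rule exp_ge_add_one_self)
  finally have "pass \<beta> K m ^ T \<le> exp (- x) ^ T"
    by (intro power_mono pass_bounds)
  also have "\<dots> = exp (- 2)"
    using T0 by (simp only: exp_of_nat_mult[symmetric]) (simp add: x_def)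
  also have "\<dots> \<le> 1 / 3"
    using exp_ge_add_one_self[of 2] by (simp add: exp_minus inverse_eq_divide divide_simps)
  finally have "survive L (j, \<beta>) \<le> 1 / 3"
    by (simp add: survive_def K_def m_def T_def)
  then show ?thesis
    unfolding betting_tester_def using acc_foldr_stage_le[OF g, of L] by linarith
qed

end

section \<open>The number of dyadic scales\<close>

lemma dyadic_size_bound:
  fixes n :: nat and \<epsilon> :: real
  assumes "n \<ge> 1" "0 < \<epsilon>" "\<epsilon> < 1"
  obtains L where "1 \<le> L" "8 * real n / \<epsilon>\<^sup>2 \<le> 2 ^ L" "2 ^ L \<le> 16 * (real n / \<epsilon>\<^sup>2)"
    "real L \<le> 10 * (ln (2 + real n) * ln (2 + 1 / \<epsilon>))"
proof -
  define y where "y = 8 * real n / \<epsilon>\<^sup>2"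
  have e2: "0 < \<epsilon>\<^sup>2" "\<epsilon>\<^sup>2 < 1"
    using assms by (auto simp: power_less_one_iff)
  have "8 * 1 \<le> 8 * real n"
    using assms(1) by simp
  also have "\<dots> \<le> y"
    unfolding y_def using e2 assms(1) by (simp add: field_simps)
  finally have y: "8 \<le> y"
    by simp
  \<comment> \<open>Rounding the logarithm up at most doubles the power, hence 16 in place of
    8.\<close>
  define L where "L = nat \<lceil>log 2 y\<rceil>"
  have log3: "3 \<le> log 2 y"
    using y by (subst le_log_iff) auto
  then have L: "log 2 y \<le> real L" "real L < log 2 y + 1"
    unfolding L_def by linarith+
  have "y \<le> 2 powr real L"
    using L(1) y by (simp add: log_le_iff)
  then have "y \<le> 2 ^ L"
    by (simp add: powr_realpow)
  moreover have "2 powr real L \<le> 2 powr (log 2 y + 1)"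
    using L(2) by (intro powr_mono) auto
  then have "2 ^ L \<le> y * 2"
    using y by (simp add: powr_realpow powr_add)
  moreover have "real L \<le> 10 * (ln (2 + real n) * ln (2 + 1 / \<epsilon>))"
  proof -
    let ?a = "ln (2 + real n)" and ?b = "ln (2 + 1 / \<epsilon>)"
    have e3: "exp 1 \<le> (3 :: real)"
      using exp_le by simp
    have a: "1 \<le> ?a"
      using e3 assms(1) by (subst ln_ge_iff) auto
    have b: "1 \<le> ?b"
    proof -
      have "1 \<le> 1 / \<epsilon>"
        using assms by simp
      then show ?thesis
        using e3 by (subst ln_ge_iff) linarith+
    qed
    have ab: "?a \<le> ?a * ?b" "?b \<le> ?a * ?b" "1 \<le> ?a * ?b"
      using a b by (auto intro: order_trans[OF a] simp: mult_le_cancel_left1 mult_le_cancel_right1)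
    have ln2: "1 / 2 \<le> ln (2 :: real)"
      using ln2_ge_two_thirds by linarith
    have half: "z / ln 2 \<le> 2 * z" if "0 \<le> z" for z :: real
    proof -
      have "z * 1 \<le> z * (2 * ln 2)"
        using that ln2 by (intro mult_left_mono) auto
      then show ?thesis
        using ln2 by (simp add: divide_le_eq mult_ac)
    qed
    have "log 2 y = 3 + log 2 (real n) + 2 * log 2 (1 / \<epsilon>)"
    proof -
      have "y = 8 * (real n * (1 / \<epsilon>)\<^sup>2)"
        using assms by (simp add: y_def power_divide)
      moreover have "log 2 ((1 / \<epsilon>)\<^sup>2) = 2 * log 2 (1 / \<epsilon>)"
        using log_nat_power[of "1 / \<epsilon>" 2 2] assms by simp
      moreover have "log 2 8 = (3 :: real)"
        using log_pow_cancel[of 2 3] by simp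
      ultimately show ?thesis
        using assms by (simp add: log_mult)
    qed
    also have "log 2 (real n) \<le> 2 * ?a"
    proof -
      have "ln (real n) \<le> ?a" "0 \<le> ln (real n)"
        using assms(1) by auto
      then show ?thesis
        unfolding log_def using half[of "ln (real n)"] by linarith
    qed
    also have "log 2 (1 / \<epsilon>) \<le> 2 * ?b"
    proof -
      have "ln (1 / \<epsilon>) \<le> ?b" "0 \<le> ln (1 / \<epsilon>)"
        using assms by (auto intro!: ln_mono ln_ge_zero simp: field_simps)
      then show ?thesis
        unfolding log_def using half[of "ln (1 / \<epsilon>)"] by linarith
    qed
    \<comment> \<open>In total \<open>L < 4 + 2 * ?a + 4 * ?b\<close>. The shifts by 2 make both
      logarithms at least 1, so 1, \<open>?a\<close> and \<open>?b\<close> are each at most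
      \<open>?a * ?b\<close>, which gives 10.\<close>
    finally show ?thesis
      using L(2) ab by linarith
  qed
  moreover have "1 \<le> L"
    using L(1) log3 by linarith
  ultimately show ?thesis
    using that[of L] by (simp add: y_def)
qed

theorem theorem1:
  "\<exists>(C::real) (a::nat). \<forall>n::nat. \<forall>\<epsilon>::real. n \<ge> 1 \<longrightarrow> \<epsilon> > 0 \<longrightarrow>
     (\<exists>A::tester.
        ereal_of_enat (queries A)
          \<le> ereal (C * (real n / \<epsilon>\<^sup>2) * (ln (2 + real n) * ln (2 + 1 / \<epsilon>)) ^ a) \<and>
        (\<forall>\<tau> \<mu> :: bool list pmf. set_pmf \<tau> \<subseteq> cube n \<longrightarrow> set_pmf \<mu> \<subseteq> cube n \<longrightarrow>
           (\<tau> = \<mu> \<longrightarrow> pmf (run n \<tau> \<mu> A) True \<ge> 2 / 3) \<and>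
           (d_TV n \<tau> \<mu> > \<epsilon> \<longrightarrow> pmf (run n \<tau> \<mu> A) False \<ge> 2 / 3)))"
proof (rule exI[of _ "12304 * 10 ^ 5 * 16"], rule exI[of _ 5], intro allI impI)
  fix n :: nat and \<epsilon> :: real
  assume n: "n \<ge> 1" and \<epsilon>: "\<epsilon> > 0"
  \<comment> \<open>The factors come from the query bound, from \<open>L ^ 5\<close> with
    \<open>L \<le> 10 * ?l\<close>, and from
    \<open>2 ^ L \<le> 16 * (real n / \<epsilon>\<^sup>2)\<close>.\<close>
  define C :: real where "C = 12304 * 10 ^ 5 * 16"
  let ?l = "ln (2 + real n) * ln (2 + 1 / \<epsilon>)"
  let ?B = "C * (real n / \<epsilon>\<^sup>2) * ?l ^ 5"
  have "\<exists>A. ereal_of_enat (queries A) \<le> ereal ?B \<and>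
      (\<forall>\<tau> \<mu> :: bool list pmf. set_pmf \<tau> \<subseteq> cube n \<longrightarrow> set_pmf \<mu> \<subseteq> cube n \<longrightarrow>
         (\<tau> = \<mu> \<longrightarrow> pmf (run n \<tau> \<mu> A) True \<ge> 2 / 3) \<and>
         (d_TV n \<tau> \<mu> > \<epsilon> \<longrightarrow> pmf (run n \<tau> \<mu> A) False \<ge> 2 / 3))"
  proof (cases "\<epsilon> < 1")
    case False
    \<comment> \<open>For \<open>\<epsilon> \<ge> 1\<close> no pair is farther apart than
      \<epsilon>, so accepting without any query is correct.\<close>
    have "0 \<le> ?B"
      using \<epsilon> by (auto simp: C_def intro!: mult_nonneg_nonneg zero_le_power)
    moreover have "\<not> d_TV n \<tau> \<mu> > \<epsilon>" if "set_pmf \<tau> \<subseteq> cube n" "set_pmf \<mu> \<subseteq> cube n" for \<tau> \<mu>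
      using d_TV_le_1[OF that] False by linarith
    ultimately show ?thesis
      by (intro exI[of _ "Verdict True"]) (auto simp: zero_enat_def)
  next
    case True
    obtain L where L: "1 \<le> L" "8 * real n / \<epsilon>\<^sup>2 \<le> 2 ^ L" "2 ^ L \<le> 16 * (real n / \<epsilon>\<^sup>2)"
      "real L \<le> 10 * ?l"
      using dyadic_size_bound[OF n \<epsilon> True] by blast
    have "ereal_of_enat (queries (betting_tester n L)) \<le> ereal_of_enat (enat (12304 * L ^ 5 * 2 ^ L))"
      using queries_betting_tester by (simp only: ereal_of_enat_le_iff)
    also have "\<dots> = ereal (12304 * real L ^ 5 * 2 ^ L)"
      by simp
    also have "12304 * real L ^ 5 * 2 ^ L \<le> 12304 * (10 * ?l) ^ 5 * (16 * (real n / \<epsilon>\<^sup>2))"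
      using L \<epsilon> by (intro mult_mono power_mono mult_nonneg_nonneg zero_le_power) auto
    also have "\<dots> = ?B"
      unfolding C_def power_mult_distrib by (simp add: mult_ac)
    finally have "ereal_of_enat (queries (betting_tester n L)) \<le> ereal ?B"
      by simp
    moreover have "(\<tau> = \<mu> \<longrightarrow> pmf (run n \<tau> \<mu> (betting_tester n L)) True \<ge> 2 / 3) \<and>
         (d_TV n \<tau> \<mu> > \<epsilon> \<longrightarrow> pmf (run n \<tau> \<mu> (betting_tester n L)) False \<ge> 2 / 3)"
      if "set_pmf \<tau> \<subseteq> cube n" "set_pmf \<mu> \<subseteq> cube n" for \<tau> \<mu>
    proof -
      interpret oracle_pair n \<tau> \<mu>
        using n that by unfold_locales
      show ?thesis
        using betting_tester_complete[OF _ L(1)] betting_tester_sound[OF _ \<epsilon> L(2,1)]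
        unfolding accept_def pmf_bool_False by auto
    qed
    ultimately show ?thesis
      by blast
  qed
  then show "\<exists>A. ereal_of_enat (queries A)
          \<le> ereal (12304 * 10 ^ 5 * 16 * (real n / \<epsilon>\<^sup>2) * (ln (2 + real n) * ln (2 + 1 / \<epsilon>)) ^ 5) \<and>
        (\<forall>\<tau> \<mu> :: bool list pmf. set_pmf \<tau> \<subseteq> cube n \<longrightarrow> set_pmf \<mu> \<subseteq> cube n \<longrightarrow>
           (\<tau> = \<mu> \<longrightarrow> pmf (run n \<tau> \<mu> A) True \<ge> 2 / 3) \<and>
           (d_TV n \<tau> \<mu> > \<epsilon> \<longrightarrow> pmf (run n \<tau> \<mu> A) False \<ge> 2 / 3))"
    unfolding C_def .
qed

end
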